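(* Let $f:\mathbb{F}_2^n\to\mathbb{F}_2$. Then $f$ cannot be both $\wedge$-decomposable and $\oplus$-decomposable.
   Context: For a symmetric operation $\odot$ on arbitrarily many inputs, $f(x_1,\dots,x_n)$ is $\odot$-decomposable if there is a partition $\{x_1,\dots,x_n\}=\bigcup_{i=1}^t X_i$ with $t>1$, all $X_i$ nonempty and pairwise disjoint, and functions $f_i$ such that $f=\bigodot_{i=1}^t f_i(X_i)$. Here $\oplus$ is addition over $\mathbb{F}_2$. Standing assumption: $f$ depends on all of its $n$ variables. *)

theory Defs
  imports
    "HOL-Analysis.Finite_Cartesian_Product"
    "HOL-Library.Z2"
    "HOL-Library.Multiset"
    "HOL-Library.FuncSet"
    "HOL-Library.Disjoint_Sets"
begin

definition depends_on :: "('a ^ 'n \<Rightarrow> 'b) \<Rightarrow> 'n \<Rightarrow> bool" where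
  "depends_on f i \<longleftrightarrow> (\<exists>x y. (\<forall>j. j \<noteq> i \<longrightarrow> x $ j = y $ j) \<and> f x \<noteq> f y)"

text \<open>
  A symmetric operation on arbitrarily many inputs is a function on multisets. Variables are
  identified with their indices. The component function of a block \<open>X\<close> only sees the input
  restricted to \<open>X\<close>, i.e. an element of \<open>X \<rightarrow>\<^sub>E UNIV\<close>.
\<close>

definition decomposable :: "('b multiset \<Rightarrow> 'b) \<Rightarrow> ('a ^ 'n \<Rightarrow> 'b) \<Rightarrow> bool" where
  "decomposable bigop f \<longleftrightarrow>
     (\<exists>(P :: 'n set set) (g :: 'n set \<Rightarrow> ('n \<Rightarrow> 'a) \<Rightarrow> 'b).
        partition_on UNIV P \<and> card P > 1 \<and>
        (\<forall>x. f x = bigop {# g X (restrict (($) x) X). X \<in># mset_set P #}))"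

text \<open>On \<open>bit\<close>, conjunction is multiplication and exclusive or is addition.\<close>

definition and_decomposable :: "(bit ^ 'n \<Rightarrow> bit) \<Rightarrow> bool" where
  "and_decomposable = decomposable prod_mset"

definition xor_decomposable :: "(bit ^ 'n \<Rightarrow> bit) \<Rightarrow> bool" where
  "xor_decomposable = decomposable sum_mset"

lemma prod_mset_bit_eq_1_iff: "prod_mset M = (1 :: bit) \<longleftrightarrow> (\<forall>b\<in>#M. b = 1)"
  by (induction M) auto

end

(* For variables i, j consider the second-order difference of f in the directions i and j. If i and
   j lie in different blocks of an xor-decomposition, it vanishes identically. If they lie in
   different blocks of an and-decomposition, it is a product of first-order differences of
   components, which does not vanish identically because f depends on both variables. Hence
   variables separated by the and-partition are never separated by the xor-partition; since the
   and-partition is nontrivial, the xor-partition would be trivial. *)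

theory Submission
  imports Defs
begin

lemma restrict_vec_eq:
  assumes "\<And>k. k \<noteq> i \<Longrightarrow> u $ k = v $ k" and "i \<notin> Z"
  shows "restrict (($) u) Z = restrict (($) v) Z"
  by (rule restrict_ext) (metis assms)

text \<open>The four points are the corners of a square in the directions \<open>i\<close> and
  \<open>j\<close>. Each block misses one of the two indices, so its summand is blind to that move
  and its four values agree in pairs. Stating this as an equation between two sums avoids
  subtraction, so a commutative monoid suffices.\<close>

lemma sum_blocks_exchange:
  fixes g :: "'n::finite set \<Rightarrow> ('n \<Rightarrow> 'a) \<Rightarrow> 'b::comm_monoid_add" and z zi zj zij :: "'a ^ 'n"
  assumes f: "\<And>x. f x = (\<Sum>Y\<in>Q. g Y (restrict (($) x) Y))"
    and sep: "\<And>Y. Y \<in> Q \<Longrightarrow> i \<notin> Y \<or> j \<notin> Y"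
    and i: "\<And>k. k \<noteq> i \<Longrightarrow> zi $ k = z $ k" "\<And>k. k \<noteq> i \<Longrightarrow> zij $ k = zj $ k"
    and j: "\<And>k. k \<noteq> j \<Longrightarrow> zj $ k = z $ k" "\<And>k. k \<noteq> j \<Longrightarrow> zij $ k = zi $ k"
  shows "f z + f zij = f zi + f zj"
proof -
  have "g Y (restrict (($) z) Y) + g Y (restrict (($) zij) Y)
      = g Y (restrict (($) zi) Y) + g Y (restrict (($) zj) Y)" if "Y \<in> Q" for Y
    using sep[OF that]
  proof
    assume "i \<notin> Y"
    then have "restrict (($) zi) Y = restrict (($) z) Y" "restrict (($) zij) Y = restrict (($) zj) Y"
      using i by (blast intro: restrict_vec_eq)+
    then show ?thesis by simp
  next
    assume "j \<notin> Y"
    then have "restrict (($) zj) Y = restrict (($) z) Y" "restrict (($) zij) Y = restrict (($) zi) Y"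
      using j by (blast intro: restrict_vec_eq)+
    then show ?thesis by (simp add: add.commute)
  qed
  then show ?thesis by (simp add: f flip: sum.distrib)
qed

lemma prod_bit_eq_1_iff:
  fixes g :: "'a \<Rightarrow> bit"
  assumes "finite A"
  shows "prod g A = 1 \<longleftrightarrow> (\<forall>a\<in>A. g a = 1)"
  using assms by (induction A) auto

lemma depends_on_bitE:
  fixes f :: "'a ^ 'n \<Rightarrow> bit"
  assumes "depends_on f i"
  obtains x y where "\<And>k. k \<noteq> i \<Longrightarrow> y $ k = x $ k" "f x = 1" "f y = 0"
proof -
  obtain x y where "\<forall>k. k \<noteq> i \<longrightarrow> x $ k = y $ k" "f x \<noteq> f y"
    using assms unfolding depends_on_def by blast
  then show thesis
    using that[of y x] that[of x y] by (cases "f x"; cases "f y") auto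
qed

text \<open>Supplies a square on which \<open>f\<close> is 1 at exactly one corner, so that the
  exchange identity for sums fails there. It is glued from a pair of points witnessing dependence on
  \<open>i\<close> and a pair witnessing dependence on \<open>j\<close>.\<close>

lemma prod_blocks_separating_point:
  fixes g :: "'n::finite set \<Rightarrow> ('n \<Rightarrow> 'a) \<Rightarrow> bit" and f :: "'a ^ 'n \<Rightarrow> bit"
  assumes f: "\<And>x. f x = (\<Prod>X\<in>P. g X (restrict (($) x) X))"
    and P: "disjoint P" "finite P"
    and X: "X \<in> P" "i \<in> X" and X': "X' \<in> P" "j \<in> X'" and ne: "X \<noteq> X'"
    and dep: "depends_on f i" "depends_on f j"
  obtains z zi zj zij where
    "\<And>k. k \<noteq> i \<Longrightarrow> zi $ k = z $ k" "\<And>k. k \<noteq> i \<Longrightarrow> zij $ k = zj $ k"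
    "\<And>k. k \<noteq> j \<Longrightarrow> zj $ k = z $ k" "\<And>k. k \<noteq> j \<Longrightarrow> zij $ k = zi $ k"
    "f z = 1" "f zi = 0" "f zj = 0" "f zij = 0"
proof -
  obtain x y where xy: "\<And>k. k \<noteq> i \<Longrightarrow> y $ k = x $ k" and fx: "f x = 1" and fy: "f y = 0"
    using depends_on_bitE[OF dep(1)] by blast
  obtain x' y' where xy': "\<And>k. k \<noteq> j \<Longrightarrow> y' $ k = x' $ k" and fx': "f x' = 1" and fy': "f y' = 0"
    using depends_on_bitE[OF dep(2)] by blast
  \<comment> \<open>Gluing along \<open>X'\<close>: by disjointness the factor of \<open>X'\<close>
    sees only \<open>v\<close>, and every other factor sees only \<open>u\<close>.\<close>
  define mix :: "'a ^ 'n \<Rightarrow> 'a ^ 'n \<Rightarrow> 'a ^ 'n"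
    where "mix u v = (\<chi> k. if k \<in> X' then v $ k else u $ k)" for u v
  have mix_X': "restrict (($) (mix u v)) X' = restrict (($) v) X'" for u v
    by (auto simp: mix_def restrict_def fun_eq_iff)
  have mix_other: "restrict (($) (mix u v)) Z = restrict (($) u) Z" if "Z \<in> P" "Z \<noteq> X'" for u v Z
    using disjointD[OF P(1) that(1) X'(1) that(2)]
    by (auto simp: mix_def restrict_def fun_eq_iff)
  have one: "f u = 1 \<longleftrightarrow> (\<forall>Z\<in>P. g Z (restrict (($) u) Z) = 1)" for u
    by (simp add: f prod_bit_eq_1_iff[OF P(2)])
  have zero: "f u = 0" if "Z \<in> P" "g Z (restrict (($) u) Z) \<noteq> 1" for u Z
    using one[of u] that by (cases "f u") auto
  \<comment> \<open>All factors are 1 at \<open>u\<close>, and a change at \<open>l\<close> reaches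
    only the block \<open>Z\<close>, so the factor of \<open>Z\<close> must cause
    \<open>f v = 0\<close>.\<close>
  have block: "g Z (restrict (($) v) Z) \<noteq> 1"
    if uv: "\<And>k. k \<noteq> l \<Longrightarrow> v $ k = u $ k" "f u = 1" "f v = 0" and Z: "Z \<in> P" "l \<in> Z" for u v l Z
  proof
    assume gZ: "g Z (restrict (($) v) Z) = 1"
    have "g W (restrict (($) v) W) = 1" if "W \<in> P" for W
    proof (cases "W = Z")
      case False
      then have "l \<notin> W" using disjointD[OF P(1) that Z(1)] Z(2) by auto
      then show ?thesis using restrict_vec_eq[OF uv(1)] one[of u] uv(2) that by metis
    qed (use gZ in simp)
    then show False using one[of v] uv(3) by simp
  qed
  have gX: "g X (restrict (($) y) X) \<noteq> 1" and gX': "g X' (restrict (($) y') X') \<noteq> 1"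
    using block[OF xy fx fy X] block[OF xy' fx' fy' X'] by blast+
  show thesis
  \<comment> \<open>The instances follow the order of first occurrence: \<open>zi\<close>,
    \<open>z\<close>, \<open>zij\<close>, \<open>zj\<close>. Passing from \<open>x\<close> to
    \<open>y\<close> is the move at \<open>i\<close>, from \<open>x'\<close> to \<open>y'\<close>
    the move at \<open>j\<close>; either one spoils a factor.\<close>
  proof (rule that[of "mix y x'" "mix x x'" "mix y y'" "mix x y'"])
    show "f (mix x x') = 1"
      unfolding one using one[of x] one[of x'] fx fx' mix_X' mix_other by metis
    show "f (mix y x') = 0" "f (mix y y') = 0"
      using zero[OF X(1)] gX mix_other[OF X(1) ne] by metis+
    show "f (mix x y') = 0"
      using zero[OF X'(1)] gX' mix_X' by metis
  qed (auto simp: mix_def xy xy')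
qed

theorem mainTheorem11:
  fixes f :: "bit ^ 'n \<Rightarrow> bit"
  assumes "\<And>i. depends_on f i"
  shows "\<not> (and_decomposable f \<and> xor_decomposable f)"
proof (rule notI, elim conjE)
  assume "and_decomposable f" "xor_decomposable f"
  obtain P g where P: "partition_on UNIV P" "card P > 1"
    and g: "\<And>x. f x = (\<Prod>X\<in>P. g X (restrict (($) x) X))"
    using \<open>and_decomposable f\<close>
    unfolding and_decomposable_def decomposable_def prod_unfold_prod_mset by blast
  obtain Q h where Q: "partition_on UNIV Q" "card Q > 1"
    and h: "\<And>x. f x = (\<Sum>Y\<in>Q. h Y (restrict (($) x) Y))"
    using \<open>xor_decomposable f\<close>
    unfolding xor_decomposable_def decomposable_def sum_unfold_sum_mset by blast
  have fin: "finite P"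
    using P(2) card.infinite by fastforce
  have together: "\<exists>Y\<in>Q. i \<in> Y \<and> j \<in> Y"
    if X: "X \<in> P" "i \<in> X" "X' \<in> P" "j \<in> X'" "X \<noteq> X'" for i j X X'
  proof (rule ccontr)
    assume sep: "\<not> (\<exists>Y\<in>Q. i \<in> Y \<and> j \<in> Y)"
    obtain z zi zj zij where z: "\<And>k. k \<noteq> i \<Longrightarrow> zi $ k = z $ k" "\<And>k. k \<noteq> i \<Longrightarrow> zij $ k = zj $ k"
      "\<And>k. k \<noteq> j \<Longrightarrow> zj $ k = z $ k" "\<And>k. k \<noteq> j \<Longrightarrow> zij $ k = zi $ k"
      and val: "f z = 1" "f zi = 0" "f zj = 0" "f zij = 0"
      by (rule prod_blocks_separating_point[OF g partition_onD2[OF P(1)] fin X assms assms]) blast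
    have "f z + f zij = f zi + f zj"
      by (rule sum_blocks_exchange[where g = h and i = i and j = j, OF h _ z]) (use sep in blast)+
    \<comment> \<open>The values turn the identity into 1 + 0 = 0 + 0.\<close>
    then show False using val by simp
  qed
  have same: "Y = Y'" if "Y \<in> Q" "Y' \<in> Q" "k \<in> Y" "k \<in> Y'" for Y Y' k
    using disjointD[OF partition_onD2[OF Q(1)]] that by blast
  have inP: "\<exists>X\<in>P. k \<in> X" and inQ: "\<exists>Y\<in>Q. k \<in> Y" for k
    using partition_onD1[OF P(1)] partition_onD1[OF Q(1)] by auto
  obtain A A' where A: "A \<in> P" "A' \<in> P" "A \<noteq> A'"
    using P(2) by (metis card_le_Suc0_iff_eq[OF fin] One_nat_def not_less)
  obtain a a' where a: "a \<in> A" "a' \<in> A'"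
    using A partition_onD3[OF P(1)] by (metis all_not_in_conv)
  obtain Y where Y: "Y \<in> Q" "a \<in> Y" "a' \<in> Y"
    using together[of A a A' a'] A a by blast
  \<comment> \<open>An index in \<open>A\<close> is compared with \<open>a'\<close>, any other index
    with \<open>a\<close>. Either way it shares a block of \<open>Q\<close> with a point of
    \<open>Y\<close>, and that block is \<open>Y\<close>.\<close>
  have "k \<in> Y" for k
  proof -
    obtain X where X: "X \<in> P" "k \<in> X" using inP by blast
    show ?thesis
    proof (cases "X = A")
      case True
      then show ?thesis using together[of A k A' a'] A a X Y same by metis
    next
      case False
      then show ?thesis using together[of X k A a] A a X Y same by metis
    qed
  qed
  \<comment> \<open>Blocks are nonempty, so any \<open>Y'\<close> meets the all-embracing
    \<open>Y\<close>.\<close>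
  then have "Y' = Y" if "Y' \<in> Q" for Y'
    using same[OF that Y(1)] partition_onD3[OF Q(1)] that by (metis all_not_in_conv)
  then have "Q = {Y}" using Y(1) by blast
  then show False using Q(2) by simp
qed

end
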